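(* There exists a countable family $\mathcal R$ of axis-parallel closed rectangles in $\mathbb{R}^2$ such that every point of $\mathbb R^2$ lies in infinitely many members of $\mathcal R$, but there is no partition $\mathcal R=\mathcal R_0\cup\mathcal R_1$ into two disjoint subfamilies each of which covers $\mathbb R^2$. *)

theory Defs
  imports Complex_Main "HOL-Library.Countable_Set"
begin

text \<open>Rectangles are bounded with sides of positive length; segments and points are excluded.\<close>

definition closed_rectangle :: "(real \<times> real) set \<Rightarrow> bool" where
  "closed_rectangle R \<longleftrightarrow> (\<exists>a b c d. a < b \<and> c < d \<and> R = {a..b} \<times> {c..d})"

end

theory Submission
  imports Defs "HOL-Analysis.Elementary_Normed_Spaces"
begin

text \<open>
  A rectangle \<open>[-a, b] \<times> [-c, d]\<close> with positive parameters meets the two branches of the hyperbola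
  \<open>x y = 1\<close> in two arcs that can be prescribed independently. This realises the hypergraph on the
  nonempty nodes of the tree of finite integer sequences whose edges are the sets of siblings (one
  point of the negative branch for each node) and the infinite branches (points of an arc of the
  positive branch). It has no proper 2-colouring: if no set of siblings is monochromatic in the first
  colour, one can descend along an infinite branch of the second colour. All remaining points of the
  plane are covered by rectangles avoiding the points used in this argument; the countably many
  endpoints on the arc are covered by rectangles that touch the hyperbola in a single point.
\<close>

section \<open>A tree of intervals\<close>

definition cut_point :: "real \<Rightarrow> real \<Rightarrow> int \<Rightarrow> real" where
  "cut_point a b n = (a + b) / 2 + (b - a) * (arctan (of_int n) / pi)"

text \<open>The cuts accumulate at both endpoints, so that every child lies in the interior of its parent.\<close>

lemma cut_point_bounds:
  assumes "a < b"
  shows "a < cut_point a b n" "cut_point a b n < b"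
proof -
  define t where "t = arctan (of_int n) / pi"
  have t: "-1/2 < t" "t < 1/2"
    using arctan_bounded[of "of_int n"] by (auto simp: t_def field_simps)
  have "(b - a) * (-1/2) < (b - a) * t" "(b - a) * t < (b - a) * (1/2)"
    using t assms by (intro mult_strict_left_mono; simp)+
  then show "a < cut_point a b n" "cut_point a b n < b"
    unfolding cut_point_def t_def[symmetric] by (simp_all add: field_simps)
qed

lemma cut_point_less:
  assumes "a < b" "m < n"
  shows "cut_point a b m < cut_point a b n"
proof -
  have "arctan (of_int m) < arctan (of_int n)"
    using assms by (simp add: arctan_less_iff)
  then show ?thesis
    using assms by (simp add: cut_point_def divide_strict_right_mono)
qed

lemma cut_point_le:
  assumes "a < b" "m \<le> n"
  shows "cut_point a b m \<le> cut_point a b n"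
  using cut_point_less[of a b m n] assms by (cases "m = n") auto

lemma cut_point_cover:
  assumes "a < x" "x < b"
  obtains n where "cut_point a b n \<le> x" "x < cut_point a b (n + 1)"
proof -
  \<comment> \<open>Solving the formula of \<open>cut_point\<close> for the arctangent gives
    \<open>t\<close>; thus \<open>tan t\<close> is the real index of a cut at \<open>x\<close>, and
    its floor is the wanted \<open>n\<close>.\<close>
  define t where "t = pi * ((x - (a + b) / 2) / (b - a))"
  have "- 1/2 < (x - (a + b) / 2) / (b - a)" "(x - (a + b) / 2) / (b - a) < 1/2"
    using assms by (auto simp: field_simps)
  then have "pi * (-1/2) < t" "t < pi * (1/2)"
    unfolding t_def by (intro mult_strict_left_mono; simp)+
  then have t: "arctan (tan t) = t"
    by (intro arctan_tan) auto
  have x: "x = (a + b) / 2 + (b - a) * (t / pi)"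
    using assms by (simp add: t_def)
  define n where "n = \<lfloor>tan t\<rfloor>"
  have "arctan (of_int n) \<le> t" "t < arctan (of_int (n + 1))"
    using t arctan_le_iff[of "of_int n" "tan t"] arctan_less_iff[of "tan t" "of_int (n + 1)"]
    unfolding n_def by linarith+
  then have "cut_point a b n \<le> x" "x < cut_point a b (n + 1)"
    using assms unfolding x cut_point_def
    by (auto intro!: mult_left_mono mult_strict_left_mono divide_right_mono divide_strict_right_mono)
  then show thesis by (rule that)
qed

text \<open>A node carries the index of its last step at the head of the list, so \<open>tl\<close>
  yields its parent.\<close>

fun lo hi :: "int list \<Rightarrow> real" where
  "lo [] = 1"
| "hi [] = 2"
| "lo (n # s) = cut_point (lo s) (hi s) n"
| "hi (n # s) = cut_point (lo s) (hi s) (n + 1)"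

lemma lo_less_hi: "lo s < hi s"
  by (induction s) (auto simp: cut_point_less)

lemma lo_Cons_gt: "lo s < lo (n # s)"
  and hi_Cons_less: "hi (n # s) < hi s"
  by (auto simp: cut_point_bounds lo_less_hi)

lemma lo_ge_1: "1 \<le> lo s"
  by (induction s) (auto intro: order.trans less_imp_le[OF lo_Cons_gt] simp del: lo.simps(2))

lemma hi_le_2: "hi s \<le> 2"
  by (induction s) (auto intro: order.trans less_imp_le[OF hi_Cons_less] simp del: hi.simps(2))

lemma lo_pos: "0 < lo s"
  using lo_ge_1[of s] by linarith

text \<open>Strict nesting puts \<open>x\<close> inside the open intervals of both parents, so these
  agree by induction, and distinct siblings share at most a cut. Allowing endpoints of
  \<open>t\<close> serves to show later that limits of branches are not endpoints.\<close>

lemma node_unique: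
  assumes "length s = length t" "lo s < x" "x < hi s" "lo t \<le> x" "x \<le> hi t"
  shows "s = t"
  using assms
proof (induction s t rule: list_induct2)
  case (Cons n s m t)
  have "s = t"
    using Cons.prems lo_Cons_gt[of s n] lo_Cons_gt[of t m] hi_Cons_less[of n s] hi_Cons_less[of m t]
    by (intro Cons.IH) linarith+
  moreover have "n = m"
  proof (rule ccontr)
    assume "n \<noteq> m"
    then consider "n + 1 \<le> m" | "m + 1 \<le> n" by linarith
    then show False
      using Cons.prems cut_point_le[OF lo_less_hi[of t], of "n + 1" m]
        cut_point_le[OF lo_less_hi[of t], of "m + 1" n] \<open>s = t\<close>
      by cases auto
  qed
  ultimately show ?case by simp
qed simp

section \<open>Branches\<close>

definition branch :: "(nat \<Rightarrow> int list) \<Rightarrow> bool" where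
  "branch f \<longleftrightarrow> f 0 = [] \<and> (\<forall>k. \<exists>n. f (Suc k) = n # f k)"

lemma branch_Suc:
  assumes "branch f"
  shows "length (f k) = k" "lo (f k) < lo (f (Suc k))" "hi (f (Suc k)) < hi (f k)"
proof -
  show "length (f k) = k"
  proof (induction k)
    case (Suc k)
    then show ?case
      using assms unfolding branch_def by (metis length_Cons)
  qed (use assms in \<open>simp add: branch_def\<close>)
  show "lo (f k) < lo (f (Suc k))" "hi (f (Suc k)) < hi (f k)"
    using assms lo_Cons_gt hi_Cons_less unfolding branch_def by metis+
qed

text \<open>The supremum of the left ends lies in every closed interval of the branch; since each
  interval contains the next in its interior, it avoids all their ends.\<close>

lemma branch_limit:
  assumes "branch f"
  obtains x where "\<And>k. lo (f k) < x" "\<And>k. x < hi (f k)"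
proof -
  have inc: "mono (\<lambda>k. lo (f k))" and dec: "antimono (\<lambda>k. hi (f k))"
    using branch_Suc[OF assms]
    by (auto simp: incseq_Suc_iff decseq_Suc_iff less_imp_le)
  have le: "lo (f j) \<le> hi (f k)" for j k
  proof -
    have "lo (f j) \<le> lo (f (max j k))"
      using incseqD[OF inc, of j "max j k"] by simp
    also have "\<dots> < hi (f (max j k))" by (rule lo_less_hi)
    also have "\<dots> \<le> hi (f k)" using decseqD[OF dec, of k "max j k"] by simp
    finally show ?thesis by simp
  qed
  define x where "x = (SUP j. lo (f j))"
  have "bdd_above (range (\<lambda>j. lo (f j)))"
    using le[of _ 0] by (rule bdd_aboveI2)
  then have lower: "lo (f k) \<le> x" for k
    unfolding x_def by (rule cSUP_upper[rotated]) simp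
  have upper: "x \<le> hi (f k)" for k
    unfolding x_def using le by (intro cSUP_least) auto
  show thesis
    using that[of x] lower upper branch_Suc(2,3)[OF assms]
    by (meson less_le_trans le_less_trans)
qed

lemma node_on_branch:
  assumes "branch f" "\<And>k. lo (f k) < x" "\<And>k. x < hi (f k)" "lo t \<le> x" "x \<le> hi t"
  shows "t = f (length t)"
  using node_unique[of "f (length t)" t x] branch_Suc(1)[OF assms(1)] assms by auto

definition endpoints :: "real set" where
  "endpoints = range lo \<union> range hi"

lemma countable_endpoints: "countable endpoints"
  unfolding endpoints_def by blast

lemma endpoints_ge_1: "e \<in> endpoints \<Longrightarrow> 1 \<le> e"
  using lo_ge_1 order.trans[OF lo_ge_1 less_imp_le[OF lo_less_hi]] unfolding endpoints_def by blast

text \<open>A node with endpoint \<open>x\<close> would lie on the branch by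
  \<open>node_on_branch\<close>, but there \<open>x\<close> is interior.\<close>

lemma limit_not_endpoint:
  assumes "branch f" "\<And>k. lo (f k) < x" "\<And>k. x < hi (f k)"
  shows "x \<notin> endpoints"
proof
  assume "x \<in> endpoints"
  then obtain t where t: "x = lo t \<or> x = hi t"
    by (auto simp: endpoints_def)
  then have "t = f (length t)"
    using lo_less_hi[of t] by (intro node_on_branch[OF assms]) auto
  then show False
    using t assms(2,3)[of "length t"] by auto
qed

text \<open>Converse of \<open>branch_limit\<close>: the half-open children exhaust the open parent,
  and a point that is no endpoint is interior to the child containing it.\<close>

lemma branch_through:
  assumes "1 \<le> x" "x \<le> 2" "x \<notin> endpoints"
  obtains f where "branch f" "\<And>k. lo (f k) < x" "\<And>k. x < hi (f k)"
proof -
  have E: "x \<noteq> lo s" "x \<noteq> hi s" for s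
    using assms(3) by (auto simp: endpoints_def)
  \<comment> \<open>The clause for \<open>k = 0\<close> pins the start to the root, as dependent
    choice leaves the initial value free.\<close>
  have "\<exists>f. \<forall>k. ((k = 0 \<longrightarrow> f k = []) \<and> lo (f k) < x \<and> x < hi (f k)) \<and> (\<exists>n. f (Suc k) = n # f k)"
  proof (rule dependent_nat_choice)
    show "\<exists>s. (0 = (0::nat) \<longrightarrow> s = []) \<and> lo s < x \<and> x < hi s"
      using assms E[of "[]"] by auto
  next
    fix s k
    assume "(k = (0::nat) \<longrightarrow> s = []) \<and> lo s < x \<and> x < hi s"
    then obtain n where "cut_point (lo s) (hi s) n \<le> x" "x < cut_point (lo s) (hi s) (n + 1)"
      using cut_point_cover by blast
    then have "lo (n # s) < x \<and> x < hi (n # s)"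
      using E(1)[of "n # s"] by auto
    then show "\<exists>t. ((Suc k = 0 \<longrightarrow> t = []) \<and> lo t < x \<and> x < hi t) \<and> (\<exists>n. t = n # s)"
      by blast
  qed
  then show thesis
    using that unfolding branch_def by blast
qed

section \<open>The rectangles\<close>

text \<open>Node \<open>s\<close> is represented by the point of the negative branch with abscissa
  \<open>- code s\<close>. Positive integers keep these points on that branch and make them a closed
  set.\<close>

definition code :: "int list \<Rightarrow> real" where
  "code s = real (Suc (to_nat s))"

lemma code_ge_1: "1 \<le> code s"
  by (simp add: code_def)

lemma code_eq_iff [simp]: "code s = code t \<longleftrightarrow> s = t"
  by (simp add: code_def)

text \<open>The lower left corner is the point representing the parent. The right and upper sides
  cut the positive branch at the abscissae \<open>hi t\<close> and \<open>lo t\<close>.\<close>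

definition tile :: "int list \<Rightarrow> (real \<times> real) set" where
  "tile t = {- code (tl t)..hi t} \<times> {- (1 / code (tl t))..1 / lo t}"

lemma mem_tile_pos: "0 < x \<Longrightarrow> (x, 1 / x) \<in> tile t \<longleftrightarrow> lo t \<le> x \<and> x \<le> hi t"
proof -
  assume x: "0 < x"
  have "0 < code (tl t)" "0 < 1 / code (tl t)" "0 < 1 / x"
    using code_ge_1[of "tl t"] x by auto
  then have "- code (tl t) \<le> x" "- (1 / code (tl t)) \<le> 1 / x"
    using x by linarith+
  moreover have "1 / x \<le> 1 / lo t \<longleftrightarrow> lo t \<le> x"
    using x lo_pos[of t] by (simp add: field_simps)
  ultimately show ?thesis
    using x unfolding tile_def by auto
qed

text \<open>The left side bounds \<open>code s\<close> from above by \<open>code (tl t)\<close>, the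
  lower side from below, so only the corner remains.\<close>

lemma mem_tile_neg: "(- code s, - (1 / code s)) \<in> tile t \<longleftrightarrow> s = tl t"
proof -
  have c: "0 < code s" "0 < code (tl t)" "0 < 1 / code s" "0 < 1 / lo t"
    using code_ge_1[of s] code_ge_1[of "tl t"] lo_pos[of t] by auto
  have "- code s \<le> hi t" "- (1 / code s) \<le> 1 / lo t"
    using c lo_pos[of t] lo_less_hi[of t] by linarith+
  moreover have "1 / code s \<le> 1 / code (tl t) \<longleftrightarrow> code (tl t) \<le> code s"
    using c by (simp add: field_simps)
  ultimately have "(- code s, - (1 / code s)) \<in> tile t \<longleftrightarrow> code s = code (tl t)"
    unfolding tile_def mem_Times_iff atLeastAtMost_iff fst_conv snd_conv neg_le_iff_le
    by linarith
  then show ?thesis by simp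
qed

text \<open>The arc cut from the positive branch determines its ends. This separates the tiles when
  infinitely many have to be exhibited.\<close>

lemma tile_eq_imp:
  assumes "tile s = tile t"
  shows "lo s = lo t" "hi s = hi t"
proof -
  have pos: "0 < lo s" "0 < hi s" "0 < lo t" "0 < hi t"
    using lo_pos[of s] lo_less_hi[of s] lo_pos[of t] lo_less_hi[of t] by linarith+
  have "lo s \<le> x \<and> x \<le> hi s \<longleftrightarrow> lo t \<le> x \<and> x \<le> hi t" if "0 < x" for x
    using mem_tile_pos[OF that, of s] mem_tile_pos[OF that, of t] assms by simp
  from this[OF pos(1)] this[OF pos(2)] this[OF pos(3)] this[OF pos(4)]
  show "lo s = lo t" "hi s = hi t"
    using lo_less_hi[of s] lo_less_hi[of t] by linarith+
qed

text \<open>The root is left out: as \<open>tl [] = []\<close>, its tile would count among those of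
  its own children.\<close>

definition tiles :: "(real \<times> real) set set" where
  "tiles = tile ` (- {[]})"

text \<open>For positive \<open>e\<close> only the lower left corner lies on the hyperbola. The
  height varies with \<open>j\<close> to give infinitely many rectangles.\<close>

definition touching :: "real \<Rightarrow> nat \<Rightarrow> (real \<times> real) set" where
  "touching e j = {e..e + 1} \<times> {1 / e..1 / e + 1 + real j}"

lemma mem_touching: "0 < e \<Longrightarrow> 0 < x \<Longrightarrow> (x, 1 / x) \<in> touching e j \<Longrightarrow> x = e"
  by (auto simp: touching_def field_simps)

section \<open>The points of the hyperbola to be kept free of fillers\<close>

definition core :: "(real \<times> real) set" where
  "core = {p. fst p * snd p = 1 \<and> fst p \<in> {1..2} \<union> range (\<lambda>s. - code s)}"

text \<open>Sets of integers are closed in the reals, which handles the negative branch. Closedness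
  leaves room for small rectangles around every point off the core.\<close>

lemma closed_core: "closed core"
proof -
  have "range (\<lambda>s. - code s) = of_int ` range (\<lambda>s :: int list. - int (Suc (to_nat s)))"
    unfolding image_image code_def by simp
  then have "closed (range (\<lambda>s. - code s))"
    using closed_of_int_image by metis
  then have "closed (fst -` ({1..2} \<union> range (\<lambda>s. - code s)) :: (real \<times> real) set)"
    by (intro closed_vimage continuous_intros closed_Un closed_atLeastAtMost)
  moreover have "closed {p :: real \<times> real. fst p * snd p = 1}"
    by (intro closed_Collect_eq continuous_intros)
  moreover have "core = {p. fst p * snd p = 1} \<inter> fst -` ({1..2} \<union> range (\<lambda>s. - code s))"
    by (auto simp: core_def)
  ultimately show ?thesis
    by (metis closed_Int)
qed

lemma core_pos: "1 \<le> x \<Longrightarrow> x \<le> 2 \<Longrightarrow> (x, 1 / x) \<in> core"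
  by (simp add: core_def)

lemma core_neg: "(- code s, - (1 / code s)) \<in> core"
  using code_ge_1[of s] by (simp add: core_def)

lemma core_cases:
  assumes "p \<in> core"
  obtains x where "1 \<le> x" "x \<le> 2" "p = (x, 1 / x)"
  | s where "p = (- code s, - (1 / code s))"
proof -
  obtain x y where p: "p = (x, y)" by (cases p)
  have xy: "x * y = 1" and x: "x \<in> {1..2} \<union> range (\<lambda>s. - code s)"
    using assms by (auto simp: core_def p)
  have "y = 1 / x"
    using xy by (metis divide_eq_eq mult.commute mult_zero_left zero_neq_one)
  then show thesis
    using x that by (auto simp: p)
qed

section \<open>Rational rectangles covering the complement of the core\<close>

definition rat_rectangle :: "rat \<Rightarrow> rat \<Rightarrow> rat \<Rightarrow> rat \<Rightarrow> (real \<times> real) set" where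
  "rat_rectangle a b c d = {of_rat a..of_rat b} \<times> {of_rat c..of_rat d}"

definition fillers :: "(real \<times> real) set set" where
  "fillers = {rat_rectangle a b c d | a b c d. a < b \<and> c < d \<and> rat_rectangle a b c d \<inter> core = {}}"

lemma countable_fillers: "countable fillers"
proof (rule countable_subset)
  show "fillers \<subseteq> (\<lambda>(a, b, c, d). rat_rectangle a b c d) ` UNIV"
    by (auto simp: fillers_def)
qed simp

lemma rat_interval_around:
  fixes x :: real
  assumes "open A" "x \<in> A"
  obtains a b where "of_rat a < x" "x < of_rat b" "{of_rat a..of_rat b} \<subseteq> A"
proof -
  obtain e where e: "0 < e" "ball x e \<subseteq> A"
    using assms openE by blast
  obtain a where a: "x - e < of_rat a" "of_rat a < x"
    using of_rat_dense[of "x - e" x] e by auto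
  obtain b where b: "x < of_rat b" "of_rat b < x + e"
    using of_rat_dense[of x "x + e"] e by auto
  have "{of_rat a..of_rat b} \<subseteq> A"
    using a b e(2) by (auto simp: subset_eq dist_real_def abs_if)
  with a b that show thesis by blast
qed

lemma infinite_fillers:
  assumes "p \<notin> core"
  shows "infinite {R \<in> fillers. p \<in> R}"
proof -
  obtain x y where p: "p = (x, y)" by (cases p)
  have "open (- core)"
    using closed_core by auto
  then obtain A B where AB: "open A" "open B" "x \<in> A" "y \<in> B" "A \<times> B \<subseteq> - core"
    using assms p by (metis open_prod_elim ComplI mem_Sigma_iff)
  obtain a b where ab: "of_rat a < x" "x < of_rat b" "{of_rat a..of_rat b} \<subseteq> A"
    using rat_interval_around AB by metis
  obtain c d where cd: "of_rat c < y" "y < of_rat d" "{of_rat c..of_rat d} \<subseteq> B"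
    using rat_interval_around AB by metis
  \<comment> \<open>Moving the left side through the rationals between \<open>a\<close> and
    \<open>r\<close> gives infinitely many rectangles that still contain \<open>p\<close>.\<close>
  obtain r where r: "of_rat a < (of_rat r :: real)" "of_rat r < x"
    using of_rat_dense[OF ab(1)] by auto
  have "c < d"
    using cd(1,2) by (meson less_trans of_rat_less)
  have "rat_rectangle q b c d \<in> {R \<in> fillers. p \<in> R}" if "q \<in> {a<..<r}" for q
  proof -
    have q: "of_rat a < (of_rat q :: real)" "of_rat q < (of_rat r :: real)"
      using that by (auto simp: of_rat_less)
    then have "of_rat q < x" using r by linarith
    then have "q < b" using ab(2) by (meson less_trans of_rat_less)
    have "rat_rectangle q b c d \<subseteq> A \<times> B"
      unfolding rat_rectangle_def
    proof (rule Sigma_mono)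
      show "{of_rat q..of_rat b} \<subseteq> A" using q(1) ab(3) by (auto simp: subset_eq)
    qed (use cd in auto)
    moreover have "p \<in> rat_rectangle q b c d"
      using \<open>of_rat q < x\<close> ab cd by (simp add: rat_rectangle_def p)
    ultimately show ?thesis
      using \<open>q < b\<close> \<open>c < d\<close> AB(5) unfolding fillers_def by blast
  qed
  moreover have "inj_on (\<lambda>q. rat_rectangle q b c d) {a<..<r}"
  proof (rule inj_onI)
    fix q q'
    assume qs: "q \<in> {a<..<r}" "q' \<in> {a<..<r}" and eq: "rat_rectangle q b c d = rat_rectangle q' b c d"
    have "of_rat r < (of_rat b :: real)" using r ab by linarith
    then have "q < b" "q' < b" using qs by (auto simp: of_rat_less)
    have ne: "{of_rat c..of_rat d :: real} \<noteq> {}"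
      using \<open>c < d\<close> by (simp add: of_rat_less_eq)
    then have "{of_rat q..of_rat b :: real} = {of_rat q'..of_rat b}"
      using eq unfolding rat_rectangle_def by (auto simp: times_eq_iff)
    then show "q = q'"
      using \<open>q < b\<close> \<open>q' < b\<close> by (simp add: Icc_eq_Icc of_rat_less_eq)
  qed
  moreover have "infinite {a<..<r}"
    using r by (simp add: of_rat_less)
  ultimately show ?thesis
    by (metis (no_types, lifting) finite_imageD finite_subset image_subsetI)
qed

section \<open>The whole family and its members at points of the core\<close>

definition family :: "(real \<times> real) set set" where
  "family = tiles \<union> (\<lambda>(e, j). touching e j) ` (endpoints \<times> UNIV) \<union> fillers"

lemma countable_family: "countable family"
  unfolding family_def tiles_def
  by (intro countable_Un countable_image countable_SIGMA countable_endpoints countable_fillers) auto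

lemma closed_rectangle_family:
  assumes "R \<in> family"
  shows "closed_rectangle R"
proof -
  have "closed_rectangle (tile t)" for t
  proof -
    have "0 < code (tl t)" "0 < 1 / code (tl t)" "0 < 1 / lo t"
      using code_ge_1[of "tl t"] lo_pos[of t] by auto
    then have "- code (tl t) < hi t" "- (1 / code (tl t)) < 1 / lo t"
      using lo_pos[of t] lo_less_hi[of t] by linarith+
    then show ?thesis unfolding closed_rectangle_def tile_def by blast
  qed
  moreover have "closed_rectangle (touching e j)" for e j
  proof -
    have "e < e + 1" "1 / e < 1 / e + 1 + real j" by auto
    then show ?thesis unfolding closed_rectangle_def touching_def by blast
  qed
  moreover have "closed_rectangle R" if R: "R \<in> fillers" for R
  proof -
    obtain a b c d where "a < b" "c < d" "R = rat_rectangle a b c d"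
      using R by (auto simp: fillers_def)
    moreover from this have "of_rat a < (of_rat b :: real)" "of_rat c < (of_rat d :: real)"
      by (simp_all add: of_rat_less)
    ultimately show ?thesis unfolding closed_rectangle_def rat_rectangle_def by blast
  qed
  ultimately show ?thesis
    using assms by (auto simp: family_def tiles_def)
qed

text \<open>This realises the sets of siblings as edges: fillers avoid the core, and touching
  rectangles lie in the first quadrant.\<close>

lemma family_at_node:
  "R \<in> family \<and> (- code s, - (1 / code s)) \<in> R \<longleftrightarrow> R \<in> range (\<lambda>n. tile (n # s))"
proof
  assume R: "R \<in> family \<and> (- code s, - (1 / code s)) \<in> R"
  then have "R \<notin> fillers"
    using core_neg[of s] by (auto simp: fillers_def)
  moreover have "(- code s, - (1 / code s)) \<notin> touching e j" if "e \<in> endpoints" for e j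
    using endpoints_ge_1[OF that] code_ge_1[of s] by (auto simp: touching_def)
  ultimately obtain t where "t \<noteq> []" "R = tile t"
    using R by (auto simp: family_def tiles_def)
  moreover from this have "s = tl t"
    using R mem_tile_neg by metis
  ultimately show "R \<in> range (\<lambda>n. tile (n # s))"
    by (cases t) auto
qed (auto simp: family_def tiles_def mem_tile_neg)

text \<open>Fillers avoid the core, and touching rectangles meet the positive branch only at
  endpoints, so tiles alone remain.\<close>

lemma family_at_limit:
  assumes "1 \<le> x" "x \<le> 2" "x \<notin> endpoints" "R \<in> family" "(x, 1 / x) \<in> R"
  obtains t where "t \<noteq> []" "R = tile t" "lo t \<le> x" "x \<le> hi t"
proof -
  have "R \<notin> fillers"
    using core_pos[OF assms(1,2)] assms(5) by (auto simp: fillers_def)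
  moreover have "(x, 1 / x) \<notin> touching e j" if "e \<in> endpoints" for e j
    using mem_touching[of e x j] endpoints_ge_1[OF that] assms that by auto
  ultimately obtain t where "t \<noteq> []" "R = tile t"
    using assms(4,5) by (auto simp: family_def tiles_def)
  then show thesis
    using that mem_tile_pos[of x t] assms by auto
qed

lemma infinite_members:
  fixes g :: "'i \<Rightarrow> 'a set"
  assumes "inj g" "infinite (UNIV :: 'i set)" "\<And>i. g i \<in> \<F>" "\<And>i. p \<in> g i"
  shows "infinite {R \<in> \<F>. p \<in> R}"
proof -
  have "infinite (range g)"
    using assms by (simp add: finite_image_iff)
  moreover have "range g \<subseteq> {R \<in> \<F>. p \<in> R}" using assms by auto
  ultimately show ?thesis using finite_subset by blast
qed

text \<open>The sources are: fillers off the core, touching rectangles of all heights at endpoints,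
  tiles along a branch at the other points of the arc, and tiles of all children at the point of a
  node.\<close>

lemma infinite_family: "infinite {R \<in> family. p \<in> R}"
proof (cases "p \<in> core")
  case False
  have "{R \<in> fillers. p \<in> R} \<subseteq> {R \<in> family. p \<in> R}"
    by (auto simp: family_def)
  then show ?thesis
    using infinite_fillers[OF False] finite_subset by blast
next
  case True
  from True show ?thesis
  proof (cases rule: core_cases)
    case (1 x)
    show ?thesis
    proof (cases "x \<in> endpoints")
      case True
      show ?thesis
      proof (rule infinite_members[of "touching x"])
        show "inj (touching x)"
          by (rule injI) (simp add: touching_def times_eq_iff Icc_eq_Icc)
        show "touching x j \<in> family" for j
          using True by (auto simp: family_def)
        show "p \<in> touching x j" for j
          by (simp add: touching_def 1)
      qed simp
    next
      case False
      then obtain f where f: "branch f" "\<And>k. lo (f k) < x" "\<And>k. x < hi (f k)"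
        using branch_through 1 by metis
      have mono: "strict_mono (\<lambda>k. lo (f k))"
        using branch_Suc(2)[OF f(1)] by (simp add: strict_mono_Suc_iff)
      have "inj (\<lambda>k. tile (f (Suc k)))"
      proof (rule injI)
        fix i j
        assume "tile (f (Suc i)) = tile (f (Suc j))"
        then have "lo (f (Suc i)) = lo (f (Suc j))"
          by (rule tile_eq_imp)
        then show "i = j"
          using strict_mono_eq[OF mono, of "Suc i" "Suc j"] by simp
      qed
      moreover have "f (Suc k) \<noteq> []" for k
        using branch_Suc(1)[OF f(1), of "Suc k"] by auto
      moreover have "p \<in> tile (f k)" for k
        using mem_tile_pos[of x] f(2,3) 1 by (auto simp: less_imp_le)
      ultimately show ?thesis
        by (intro infinite_members[of "\<lambda>k. tile (f (Suc k))"])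
          (auto simp: family_def tiles_def simp del: lo.simps hi.simps)
    qed
  next
    case (2 s)
    have mono: "strict_mono (\<lambda>n. lo (n # s))"
      by (rule strict_monoI) (simp add: cut_point_less lo_less_hi)
    have "inj (\<lambda>n. tile (n # s))"
    proof (rule injI)
      fix m n
      assume "tile (m # s) = tile (n # s)"
      then have "lo (m # s) = lo (n # s)"
        by (rule tile_eq_imp)
      then show "m = n"
        using strict_mono_eq[OF mono, of m n] by blast
    qed
    then show ?thesis
    proof (rule infinite_members)
      show "tile (n # s) \<in> family" "p \<in> tile (n # s)" for n
        using family_at_node[of "tile (n # s)" s] by (auto simp: 2)
    qed (rule infinite_UNIV_int)
  qed
qed

theorem theorem7p2:
  "\<exists>\<R> :: (real \<times> real) set set.
     countable \<R> \<and>
     (\<forall>R\<in>\<R>. closed_rectangle R) \<and>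
     (\<forall>p. infinite {R \<in> \<R>. p \<in> R}) \<and>
     \<not> (\<exists>\<R>\<^sub>0 \<R>\<^sub>1. \<R> = \<R>\<^sub>0 \<union> \<R>\<^sub>1 \<and> \<R>\<^sub>0 \<inter> \<R>\<^sub>1 = {} \<and>
            \<Union>\<R>\<^sub>0 = UNIV \<and> \<Union>\<R>\<^sub>1 = UNIV)"
proof (rule exI[of _ family], intro conjI notI)
  show "countable family" by (rule countable_family)
  show "\<forall>R\<in>family. closed_rectangle R" using closed_rectangle_family by blast
  show "\<forall>p. infinite {R \<in> family. p \<in> R}" using infinite_family by blast
next
  assume "\<exists>\<R>\<^sub>0 \<R>\<^sub>1. family = \<R>\<^sub>0 \<union> \<R>\<^sub>1 \<and> \<R>\<^sub>0 \<inter> \<R>\<^sub>1 = {} \<and> \<Union>\<R>\<^sub>0 = UNIV \<and> \<Union>\<R>\<^sub>1 = UNIV"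
  then obtain S T where ST: "family = S \<union> T" "S \<inter> T = {}" "\<Union>S = UNIV" "\<Union>T = UNIV"
    by blast
  \<comment> \<open>\<open>T\<close> covers the point representing \<open>s\<close>, where only
    tiles of children of \<open>s\<close> are available.\<close>
  have child: "\<exists>n. tile (n # s) \<in> T" for s
  proof -
    obtain R where "R \<in> T" "(- code s, - (1 / code s)) \<in> R"
      using ST(4) by (metis UNIV_I Union_iff)
    then show ?thesis
      using family_at_node[of R s] ST(1) by auto
  qed
  \<comment> \<open>Level 0 is exempt from the colour condition because \<open>tiles\<close> omits
    the root.\<close>
  have "\<exists>f. \<forall>k. ((k = 0 \<longrightarrow> f k = []) \<and> (k \<noteq> 0 \<longrightarrow> tile (f k) \<in> T)) \<and> (\<exists>n. f (Suc k) = n # f k)"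
    by (rule dependent_nat_choice) (use child in auto)
  then obtain f where f: "branch f" "\<And>k. k \<noteq> 0 \<Longrightarrow> tile (f k) \<in> T"
    unfolding branch_def by blast
  obtain x where x: "\<And>k. lo (f k) < x" "\<And>k. x < hi (f k)"
    using branch_limit[OF f(1)] by blast
  have "1 \<le> x" "x \<le> 2"
    using x[of 0] lo_ge_1[of "f 0"] hi_le_2[of "f 0"] by linarith+
  \<comment> \<open>\<open>S\<close> must cover the limit point too, but every member of the family
    there is a tile of the branch below the root, hence in \<open>T\<close>.\<close>
  obtain R where R: "R \<in> S" "(x, 1 / x) \<in> R"
    using ST(3) by (metis UNIV_I Union_iff)
  have "R \<in> family" using R ST(1) by blast
  then obtain t where t: "t \<noteq> []" "R = tile t" "lo t \<le> x" "x \<le> hi t"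
    using family_at_limit \<open>1 \<le> x\<close> \<open>x \<le> 2\<close> limit_not_endpoint[OF f(1) x] R(2) by metis
  have "t = f (length t)"
    using node_on_branch[OF f(1) x t(3,4)] .
  then have "R \<in> T"
    using f(2)[of "length t"] t(1,2) by simp
  then show False
    using R(1) ST(2) by blast
qed

end
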